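(* Let $q > 4\cdot 10^5$ be an integer and let $\chi$ be an even primitive real Dirichlet character modulo $q$. Suppose that $\beta_0 \in (0,1)$ is a real zero of $L(s,\chi)$ with $\beta_0 \geq 1-\frac{100}{\sqrt{q}\log^2 q}$. Then for every real $\sigma \in (\beta_0,1)$, $$\left| L'(\sigma,\chi)\right| \leq \frac{1}{8}\log^2 q .$$
   Context: A Dirichlet character $\chi$ is even if $\chi(-1)=1$, and real if it takes only real values. For a non-principal Dirichlet character $\chi$ and $\Re(s)>0$, $L(s,\chi)=\sum_{n=1}^{\infty}\chi(n)n^{-s}$ (a convergent, in general conditionally convergent, series), and $L'(s,\chi)$ is its derivative in $s$. $\log$ is the natural logarithm and $\log^2 q=(\log q)^2$. *)

theory Defs
  imports "HOL-Analysis.Analysis"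
begin

text \<open>
  Characters are functions on the integers, so that \<open>chi (- 1)\<close> makes sense. For \<open>q > 0\<close>
  the three conditions give \<open>chi 1 = 1\<close>.
\<close>

definition dirichlet_character :: "nat \<Rightarrow> (int \<Rightarrow> complex) \<Rightarrow> bool" where
  "dirichlet_character q chi \<longleftrightarrow>
     (\<forall>a. chi (a + int q) = chi a) \<and>
     (\<forall>a b. chi (a * b) = chi a * chi b) \<and>
     (\<forall>a. chi a \<noteq> 0 \<longleftrightarrow> coprime a (int q))"

definition induced_from :: "nat \<Rightarrow> (int \<Rightarrow> complex) \<Rightarrow> nat \<Rightarrow> bool" where
  "induced_from q chi d \<longleftrightarrow>
     d dvd q \<and> (\<exists>\<psi>. dirichlet_character d \<psi> \<and> (\<forall>a. coprime a (int q) \<longrightarrow> chi a = \<psi> a))"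

definition primitive_character :: "nat \<Rightarrow> (int \<Rightarrow> complex) \<Rightarrow> bool" where
  "primitive_character q chi \<longleftrightarrow>
     dirichlet_character q chi \<and> (\<forall>d<q. \<not> induced_from q chi d)"

definition even_character :: "(int \<Rightarrow> complex) \<Rightarrow> bool" where
  "even_character chi \<longleftrightarrow> chi (- 1) = 1"

definition real_character :: "(int \<Rightarrow> complex) \<Rightarrow> bool" where
  "real_character chi \<longleftrightarrow> (\<forall>a. chi a \<in> \<real>)"

text \<open>
  The sum is the limit of the partial sums in the natural order, as the series is only
  conditionally convergent for \<open>0 < Re s \<le> 1\<close>; the index is shifted to start at \<open>0\<close>.
  For non-principal \<open>chi\<close> this is the L-function on the half-plane \<open>Re s > 0\<close>; it is not
  an analytic continuation to \<open>Re s \<le> 0\<close>.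
\<close>

definition dirichlet_L :: "(int \<Rightarrow> complex) \<Rightarrow> complex \<Rightarrow> complex" where
  "dirichlet_L chi s = (\<Sum>n. chi (int (Suc n)) * of_nat (Suc n) powr (- s))"

end

theory Submission
  imports
    Defs
    "HOL-Complex_Analysis.Complex_Analysis"
    "HOL-Number_Theory.Residues"
    "HOL-Library.Real_Mod"
begin

text \<open>
  Write \<open>S m\<close> for the sum of \<open>chi k\<close> over \<open>k \<le> m\<close>. Since \<open>chi\<close> is even, twice the sum of
  \<open>S m\<close> over \<open>m < N\<close> is the double sum of \<open>chi (j - k)\<close> over \<open>j, k < N\<close>, which a Gauss sum
  expansion and Parseval bound by \<open>sqrt q * N\<close>. Let \<open>f x = ln x * x powr - \<sigma>\<close>, so that
  \<open>L'(\<sigma>) = - (\<Sum>n. chi n * f n)\<close>, let \<open>A\<close> be about \<open>sqrt q\<close>, and let \<open>g\<close> agree with \<open>f\<close>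
  from \<open>A\<close> on and continue \<open>f\<close> linearly below \<open>A\<close>. As \<open>g\<close> is convex and decreasing,
  summation by parts twice bounds the sum of \<open>chi n * g n\<close> by about \<open>f A * sqrt q\<close>. The remaining sum of
  \<open>chi n * (f n - g n)\<close> over \<open>n < A\<close> is estimated termwise. Together this gives
  \<open>(ln A)\<^sup>2 / 2\<close> minus a multiple of \<open>ln A\<close>, and \<open>\<beta>\<^sub>0\<close> is so close to \<open>1\<close> that the factor
  \<open>A powr (1 - \<sigma>)\<close> only costs a part of that saving.
\<close>

section \<open>Residues and roots of unity\<close>

text \<open>Take for \<open>t\<close> the product of the primes of \<open>q\<close> that do not
  divide \<open>a\<close>: each prime of \<open>q\<close> then divides exactly one of
  \<open>a\<close> and \<open>d * t\<close>. This lifts units modulo \<open>d\<close> to units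
  modulo \<open>q\<close>.\<close>

lemma coprime_lift:
  fixes a d q :: int
  assumes "q \<noteq> 0" "coprime a d"
  obtains t where "coprime (a + d * t) q"
proof -
  define t where "t = \<Prod>{p \<in> prime_factors q. \<not> p dvd a}"
  have "coprime (a + d * t) q"
  proof (rule ccontr)
    assume "\<not> coprime (a + d * t) q"
    then have "\<not> is_unit (gcd (a + d * t) q)"
      by (simp add: coprime_iff_gcd_eq_1)
    moreover have "gcd (a + d * t) q \<noteq> 0"
      using assms(1) by simp
    ultimately obtain p where "prime p" "p dvd gcd (a + d * t) q"
      using prime_divisor_exists by blast
    then have p: "prime p" "p dvd a + d * t" "p dvd q"
      by auto
    then have pq: "p \<in> prime_factors q"
      using assms(1) by (auto simp: prime_factors_dvd)
    have t_iff: "p dvd t \<longleftrightarrow> \<not> p dvd a"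
    proof
      assume "\<not> p dvd a"
      then show "p dvd t" unfolding t_def using pq by (intro dvd_prodI) auto
    next
      assume "p dvd t"
      then obtain r where "r \<in> prime_factors q" "\<not> r dvd a" "p dvd r"
        unfolding t_def using p(1) by (auto simp: prime_dvd_prod_iff)
      then show "\<not> p dvd a"
        using p(1) primes_dvd_imp_eq by blast
    qed
    show False
    proof (cases "p dvd a")
      case True
      then have "p dvd d * t" using p(2) dvd_add_right_iff by blast
      then have "p dvd d" using t_iff True p(1) prime_dvd_mult_iff by blast
      then show False using True assms(2) p(1) by (meson coprime_common_divisor not_prime_unit)
    next
      case False
      then have "p dvd d * t" using t_iff by simp
      then show False using False p(2) dvd_add_left_iff by blast
    qed
  qed
  then show ?thesis using that by blast
qed

lemma bij_betw_mult_mod: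
  fixes b :: int
  assumes "0 < m" "coprime b m"
  shows "bij_betw (\<lambda>n. b * n mod m) {0..<m} {0..<m}"
proof -
  have "inj_on (\<lambda>n. b * n mod m) {0..<m}"
  proof (rule inj_onI)
    fix x y assume xy: "x \<in> {0..<m}" "y \<in> {0..<m}" "b * x mod m = b * y mod m"
    then have "[x = y] (mod m)"
      using cong_mult_lcancel[of b m x y] assms(2) by (simp add: cong_def)
    with xy show "x = y" by (simp add: cong_def)
  qed
  moreover have "(\<lambda>n. b * n mod m) ` {0..<m} \<subseteq> {0..<m}"
    using assms(1) by auto
  ultimately show ?thesis
    by (simp add: bij_betw_def endo_inj_surj)
qed

lemma sum_residues_mult:
  fixes h :: "int \<Rightarrow> 'a::comm_monoid_add"
  assumes "0 < m" "coprime b m" and "\<And>n. h (n mod m) = h n"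
  shows "(\<Sum>n\<in>{0..<m}. h (b * n)) = (\<Sum>n\<in>{0..<m}. h n)"
  using sum.reindex_bij_betw[OF bij_betw_mult_mod[OF assms(1,2)], of h] by (simp add: assms(3))

section \<open>Additive characters modulo \<open>q\<close> and their orthogonality\<close>

definition unity_root :: "nat \<Rightarrow> int \<Rightarrow> complex" where
  "unity_root q k = cis (2 * pi * of_int k / of_nat q)"

lemma unity_root_add: "unity_root q (a + b) = unity_root q a * unity_root q b"
  by (simp add: unity_root_def cis_mult add_divide_distrib distrib_left)

lemma unity_root_0 [simp]: "unity_root q 0 = 1"
  by (simp add: unity_root_def)

lemma cnj_unity_root: "cnj (unity_root q k) = unity_root q (- k)"
  by (simp add: unity_root_def cis_cnj)

lemma unity_root_power: "unity_root q k ^ n = unity_root q (k * int n)"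
  by (simp add: unity_root_def Complex.DeMoivre) (simp add: mult_ac)

lemma unity_root_eq_1_iff:
  assumes "0 < q"
  shows "unity_root q k = 1 \<longleftrightarrow> int q dvd k"
proof -
  have "unity_root q k = 1 \<longleftrightarrow> (\<exists>n. k = n * int q)"
  proof -
    have "(2 * pi * of_int k / of_nat q = of_int n * (2 * pi)) \<longleftrightarrow> k = n * int q" for n
    proof -
      have "(2 * pi * of_int k / of_nat q = of_int n * (2 * pi)) \<longleftrightarrow> (real_of_int k = real_of_int n * real q)"
        using assms by (simp add: field_simps)
      also have "\<dots> \<longleftrightarrow> real_of_int k = real_of_int (n * int q)" by simp
      finally show ?thesis by (simp only: of_int_eq_iff)
    qed
    then show ?thesis by (simp add: unity_root_def cis_eq_1_iff)
  qed
  then show ?thesis by (auto simp: dvd_def mult.commute)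
qed

lemma unity_root_cong:
  assumes "0 < q" "[a = b] (mod int q)"
  shows "unity_root q a = unity_root q b"
proof -
  have "unity_root q (a - b) = 1"
    using assms by (simp add: unity_root_eq_1_iff cong_iff_dvd_diff)
  then show ?thesis
    using unity_root_add[of q "a - b" b] by simp
qed

lemma sum_residues_nat: "(\<Sum>a\<in>{0..<int q}. h a) = (\<Sum>a<q. h (int a))"
proof -
  have "bij_betw int {..<q} {0..<int q}"
    by (rule bij_betwI[where g = nat]) auto
  from sum.reindex_bij_betw[OF this, of h] show ?thesis by simp
qed

lemma sum_unity_root:
  assumes "0 < q"
  shows "(\<Sum>a\<in>{0..<int q}. unity_root q (a * m)) = (if int q dvd m then of_nat q else 0)"
proof -
  have "(\<Sum>a\<in>{0..<int q}. unity_root q (a * m)) = (\<Sum>a<q. unity_root q m ^ a)"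
    by (simp add: sum_residues_nat unity_root_power mult.commute)
  also have "\<dots> = (if int q dvd m then of_nat q else 0)"
  proof (cases "int q dvd m")
    case True
    then show ?thesis using assms by (simp add: unity_root_eq_1_iff[THEN iffD2])
  next
    case False
    then have "unity_root q m \<noteq> 1" using assms by (simp add: unity_root_eq_1_iff)
    moreover have "unity_root q m ^ q = 1"
      using assms by (simp add: unity_root_power unity_root_eq_1_iff)
    ultimately show ?thesis using False by (simp add: geometric_sum)
  qed
  finally show ?thesis .
qed

text \<open>For \<open>a\<close> not divisible by \<open>q\<close> a full period of the geometric
  sum cancels, so \<open>N\<close> may be replaced by its remainder \<open>r\<close>. With
  \<open>a = 0\<close> added back, Parseval for the indicator of \<open>r\<close> distinct residues
  gives exactly \<open>q * r\<close>.\<close>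

lemma sum_norm_square_geometric_unity_root:
  assumes "0 < q"
  shows "(\<Sum>a\<in>{1..<int q}. (norm (\<Sum>j<N. unity_root q (a * int j)))\<^sup>2) \<le> real q * real N"
proof -
  define r where "r = N mod q"
  have r: "r < q" "r \<le> N" using assms by (auto simp: r_def)
  have red: "(\<Sum>j<N. unity_root q (a * int j)) = (\<Sum>j<r. unity_root q (a * int j))"
    if "a \<in> {1..<int q}" for a
  proof -
    have "\<not> int q dvd a" using that zdvd_not_zless by auto
    then have 1: "unity_root q a \<noteq> 1" using assms by (simp add: unity_root_eq_1_iff)
    have "unity_root q a ^ N = unity_root q a ^ r"
    proof -
      have "unity_root q (a * int N) = unity_root q (a * int r)"
        by (rule unity_root_cong[OF assms]) (auto simp: cong_def r_def zmod_int mod_mult_right_eq)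
      then show ?thesis by (simp add: unity_root_power)
    qed
    then show ?thesis by (simp flip: unity_root_power add: geometric_sum 1)
  qed
  have "complex_of_real (\<Sum>a\<in>{0..<int q}. (norm (\<Sum>j<r. unity_root q (a * int j)))\<^sup>2)
      = (\<Sum>a\<in>{0..<int q}. \<Sum>j<r. \<Sum>k<r. unity_root q (a * (int j - int k)))"
    unfolding of_real_sum complex_norm_square
    by (simp add: sum_product cnj_unity_root unity_root_add[symmetric] algebra_simps)
  also have "\<dots> = (\<Sum>j<r. \<Sum>k<r. \<Sum>a\<in>{0..<int q}. unity_root q (a * (int j - int k)))"
    by (subst sum.swap) (intro sum.cong refl sum.swap)
  also have "\<dots> = (\<Sum>j<r. \<Sum>k<r. if j = k then of_nat q else 0)"
  proof (intro sum.cong refl)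
    fix j k assume jk: "j \<in> {..<r}" "k \<in> {..<r}"
    have "int q dvd int j - int k \<longleftrightarrow> j = k"
    proof
      assume "int q dvd int j - int k"
      then have "[int j = int k] (mod int q)" by (simp add: cong_iff_dvd_diff)
      then show "j = k" using jk r by (simp add: cong_def)
    qed simp
    then show "(\<Sum>a\<in>{0..<int q}. unity_root q (a * (int j - int k))) = (if j = k then of_nat q else 0)"
      by (simp add: sum_unity_root[OF assms])
  qed
  also have "\<dots> = complex_of_real (real q * real r)" by simp
  finally have eq: "(\<Sum>a\<in>{0..<int q}. (norm (\<Sum>j<r. unity_root q (a * int j)))\<^sup>2) = real q * real r"
    by (simp only: of_real_eq_iff)
  have "(\<Sum>a\<in>{1..<int q}. (norm (\<Sum>j<N. unity_root q (a * int j)))\<^sup>2)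
      = (\<Sum>a\<in>{1..<int q}. (norm (\<Sum>j<r. unity_root q (a * int j)))\<^sup>2)"
    by (intro sum.cong) (simp_all add: red)
  also have "\<dots> \<le> (\<Sum>a\<in>{0..<int q}. (norm (\<Sum>j<r. unity_root q (a * int j)))\<^sup>2)"
    by (intro sum_mono2) auto
  also have "\<dots> \<le> real q * real N"
    unfolding eq using r by (intro mult_left_mono) auto
  finally show ?thesis .
qed

section \<open>Gauss sums of primitive characters\<close>

locale dirichlet_char =
  fixes q :: nat and chi :: "int \<Rightarrow> complex"
  assumes char: "dirichlet_character q chi" and q_gt_1: "1 < q"
begin

lemma chi_mult: "chi (a * b) = chi a * chi b"
  using char by (simp add: dirichlet_character_def)

lemma chi_eq_0_iff: "chi a = 0 \<longleftrightarrow> \<not> coprime a (int q)"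
  using char by (auto simp: dirichlet_character_def)

lemma chi_periodic_mult: "chi (a + int q * int k) = chi a"
proof (induction k)
  case (Suc k)
  have "chi (a + int q * int (Suc k)) = chi ((a + int q * int k) + int q)"
    by (simp add: algebra_simps)
  also have "\<dots> = chi a"
    using char Suc by (simp add: dirichlet_character_def)
  finally show ?case .
qed simp

lemma chi_cong:
  assumes "[a = b] (mod int q)"
  shows "chi a = chi b"
proof -
  have *: "chi x = chi y" if le: "x \<le> y" and xy: "[x = y] (mod int q)" for x y
  proof -
    obtain z where z: "y = x + int q * z"
      using xy by (auto simp: cong_iff_lin)
    then have "z \<ge> 0"
      using le q_gt_1 by (simp add: zero_le_mult_iff)
    then show ?thesis using z chi_periodic_mult[of x "nat z"] by simp
  qed
  show ?thesis
  proof (cases "a \<le> b")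
    case True
    then show ?thesis using assms by (rule *)
  next
    case False
    then have "b \<le> a" by simp
    then show ?thesis by (rule *[OF _ cong_sym[OF assms], symmetric])
  qed
qed

lemma chi_mod: "chi (a mod int q) = chi a"
  by (intro chi_cong) (simp add: cong_def)

lemma chi_1: "chi 1 = 1"
  using chi_mult[of 1 1] chi_eq_0_iff[of 1] by simp

lemma chi_0: "chi 0 = 0"
  using q_gt_1 by (simp add: chi_eq_0_iff)

lemma chi_power: "chi (a ^ n) = chi a ^ n"
  by (induction n) (simp_all add: chi_1 chi_mult)

text \<open>Euler's theorem makes \<open>chi a\<close> a root of unity.\<close>

lemma norm_chi:
  assumes "coprime a (int q)"
  shows "norm (chi a) = 1"
proof -
  interpret residues "int q" "residue_ring (int q)"
    by unfold_locales (use q_gt_1 in auto)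
  have "[a ^ totient (nat (int q)) = 1] (mod int q)"
    using assms by (rule euler_theorem)
  then have "chi a ^ totient q = 1"
    using chi_cong chi_power chi_1 by (metis nat_int)
  then have "norm (chi a) ^ totient q = 1"
    by (metis norm_one norm_power)
  moreover have "totient q > 0" using q_gt_1 by simp
  ultimately show ?thesis
    using power_eq_imp_eq_base[of "norm (chi a)" "totient q" 1] by simp
qed

lemma norm_chi_le: "norm (chi a) \<le> 1"
  by (cases "coprime a (int q)") (simp_all add: norm_chi chi_eq_0_iff[THEN iffD2])

text \<open>The hypothesis makes \<open>chi\<close> constant on the units of each class modulo
  \<open>d\<close>, so evaluating it at a lifted representative defines a character modulo
  \<open>d\<close>. The contrapositive supplies the unit that kills Gauss sums at frequencies not
  prime to \<open>q\<close>.\<close>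

lemma induced_fromI:
  assumes "d dvd q" and triv: "\<And>b. [b = 1] (mod int d) \<Longrightarrow> coprime b (int q) \<Longrightarrow> chi b = 1"
  shows "induced_from q chi d"
proof -
  have "d > 0" using assms(1) q_gt_1 by (auto intro: Nat.gr0I)
  have well_def: "chi a = chi b"
    if ab: "[a = b] (mod int d)" and a: "coprime a (int q)" and b: "coprime b (int q)" for a b
  proof -
    \<comment> \<open>With \<open>c\<close> an inverse of \<open>b\<close> modulo \<open>q\<close>,
      both \<open>a * c\<close> and \<open>b * c\<close> are congruent to 1 modulo \<open>d\<close>,
      so \<open>chi\<close> is 1 at both and the factor \<open>chi c\<close> cancels.\<close>
    obtain c where c: "[b * c = 1] (mod int q)"
      using cong_solve_coprime_int[OF b] by blast
    then have "coprime (b * c) (int q)"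
      by (metis cong_imp_coprime cong_sym coprime_1_left)
    then have "coprime c (int q)" by simp
    have "[a * c = b * c] (mod int d)"
      using ab by (intro cong_mult cong_refl)
    also have "[b * c = 1] (mod int d)"
      using c assms(1) by (meson cong_dvd_modulus int_dvd_int_iff)
    finally have "chi (a * c) = 1"
      using triv \<open>coprime c (int q)\<close> a by simp
    moreover have "chi (b * c) = 1"
      using c chi_cong chi_1 by metis
    ultimately have "chi a * chi c = chi b * chi c" by (simp add: chi_mult)
    moreover have "chi c \<noteq> 0" using \<open>coprime c (int q)\<close> by (simp add: chi_eq_0_iff)
    ultimately show ?thesis by simp
  qed
  define rep where "rep a = (SOME b. [b = a] (mod int d) \<and> coprime b (int q))" for a
  have rep: "[rep a = a] (mod int d)" "coprime (rep a) (int q)" if a: "coprime a (int d)" for a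
  proof -
    obtain t where "coprime (a + int d * t) (int q)"
      using coprime_lift[of "int q" a "int d"] a q_gt_1 by auto
    moreover have "[a + int d * t = a] (mod int d)" by (simp add: cong_def)
    ultimately have "[rep a = a] (mod int d) \<and> coprime (rep a) (int q)"
      unfolding rep_def by (metis (mono_tags, lifting) someI_ex)
    then show "[rep a = a] (mod int d)" "coprime (rep a) (int q)" by auto
  qed
  define \<psi> where "\<psi> a = (if coprime a (int d) then chi (rep a) else 0)" for a
  \<comment> \<open>Any unit modulo \<open>q\<close> in the class of \<open>a\<close> may serve in
    place of \<open>rep a\<close>; multiplicativity below uses \<open>rep a * rep b\<close> for the
    class of \<open>a * b\<close>.\<close>
  have \<psi>_eq: "\<psi> a = chi b" if ba: "[b = a] (mod int d)" and b: "coprime b (int q)" for a b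
  proof -
    have "coprime b (int d)"
      using b assms(1) by (meson coprime_divisors dvd_refl int_dvd_int_iff)
    then have "coprime a (int d)"
      using ba cong_imp_coprime by blast
    then have "\<psi> a = chi (rep a)" by (simp add: \<psi>_def)
    also have "\<dots> = chi b"
      by (rule well_def[OF cong_trans[OF rep(1) cong_sym[OF ba]] rep(2) b])
        (rule \<open>coprime a (int d)\<close>)+
    finally show ?thesis .
  qed
  have "dirichlet_character d \<psi>"
    unfolding dirichlet_character_def
  proof (intro conjI allI)
    fix a b
    show "\<psi> (a + int d) = \<psi> a"
    proof (cases "coprime a (int d)")
      case True
      have "\<psi> (a + int d) = chi (rep a)"
        using rep[OF True] by (intro \<psi>_eq) (auto simp: cong_def)
      then show ?thesis using True by (simp add: \<psi>_def)
    next
      case False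
      moreover have "\<not> coprime (a + int d) (int d)"
        using False by (simp add: coprime_iff_gcd_eq_1)
      ultimately show ?thesis by (simp add: \<psi>_def)
    qed
    show "\<psi> (a * b) = \<psi> a * \<psi> b"
    proof (cases "coprime a (int d) \<and> coprime b (int d)")
      case True
      then have "\<psi> (a * b) = chi (rep a * rep b)"
        using rep by (intro \<psi>_eq) (auto intro: cong_mult)
      then show ?thesis using True by (simp add: \<psi>_def chi_mult)
    next
      case False
      then show ?thesis by (auto simp: \<psi>_def)
    qed
    show "(\<psi> a \<noteq> 0) = coprime a (int d)"
      using rep by (auto simp: \<psi>_def chi_eq_0_iff)
  qed
  moreover have "chi a = \<psi> a" if "coprime a (int q)" for a
    using \<psi>_eq[of a a] that by simp
  ultimately show ?thesis
    using assms(1) unfolding induced_from_def by blast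
qed

definition gauss_sum :: "int \<Rightarrow> complex" where
  "gauss_sum a = (\<Sum>n\<in>{0..<int q}. chi n * unity_root q (a * n))"

text \<open>The substitution of \<open>b * n\<close> for \<open>n\<close> permutes the residues. It
  forces vanishing when \<open>a * b\<close> is congruent to \<open>a\<close> but
  \<open>chi b \<noteq> 1\<close>, and for \<open>a = 1\<close> it compares absolute values.\<close>

lemma gauss_sum_reindex:
  assumes "coprime b (int q)"
  shows "gauss_sum a = chi b * gauss_sum (a * b)"
proof -
  define h where "h n = chi n * unity_root q (a * n)" for n
  have "h (n mod int q) = h n" for n
  proof -
    have "unity_root q (a * (n mod int q)) = unity_root q (a * n)"
      using q_gt_1 by (intro unity_root_cong) (auto simp: cong_def mod_mult_right_eq)
    then show ?thesis by (simp add: h_def chi_mod)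
  qed
  then have "(\<Sum>n\<in>{0..<int q}. h (b * n)) = (\<Sum>n\<in>{0..<int q}. h n)"
    using q_gt_1 assms by (intro sum_residues_mult) auto
  then show ?thesis
    by (simp add: h_def gauss_sum_def sum_distrib_left chi_mult mult_ac)
qed

text \<open>Fourier inversion: orthogonality leaves only the residue \<open>n = m mod int q\<close>.
  As \<open>m\<close> is any integer, \<open>chi\<close> can be expanded at differences
  \<open>j - k\<close> of either sign.\<close>

lemma gauss_sum_inversion:
  "(\<Sum>a\<in>{0..<int q}. gauss_sum a * unity_root q (- a * m)) = of_nat q * chi m"
proof -
  have "(\<Sum>a\<in>{0..<int q}. gauss_sum a * unity_root q (- a * m))
      = (\<Sum>a\<in>{0..<int q}. \<Sum>n\<in>{0..<int q}. chi n * unity_root q (a * (n - m)))"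
    unfolding gauss_sum_def sum_distrib_right mult.assoc
    by (simp add: unity_root_add[symmetric] right_diff_distrib)
  also have "\<dots> = (\<Sum>n\<in>{0..<int q}. chi n * (\<Sum>a\<in>{0..<int q}. unity_root q (a * (n - m))))"
    by (subst sum.swap) (simp add: sum_distrib_left)
  also have "\<dots> = (\<Sum>n\<in>{0..<int q}. if n = m mod int q then of_nat q * chi n else 0)"
  proof (intro sum.cong refl)
    fix n assume n: "n \<in> {0..<int q}"
    have "int q dvd n - m \<longleftrightarrow> n mod int q = m mod int q"
      by (rule mod_eq_dvd_iff[symmetric])
    also have "\<dots> \<longleftrightarrow> n = m mod int q" using n by simp
    finally show "chi n * (\<Sum>a\<in>{0..<int q}. unity_root q (a * (n - m)))
        = (if n = m mod int q then of_nat q * chi n else 0)"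
      using q_gt_1 by (simp add: sum_unity_root)
  qed
  also have "\<dots> = of_nat q * chi (m mod int q)"
    using q_gt_1 by simp
  finally show ?thesis by (simp add: chi_mod)
qed

text \<open>Parseval: expand the conjugate factor, and the inner sum over \<open>a\<close> is the
  inversion formula.\<close>

lemma sum_norm_gauss_sum:
  "(\<Sum>a\<in>{0..<int q}. (norm (gauss_sum a))\<^sup>2) = real q * (\<Sum>a\<in>{0..<int q}. (norm (chi a))\<^sup>2)"
proof -
  have "complex_of_real (\<Sum>a\<in>{0..<int q}. (norm (gauss_sum a))\<^sup>2)
      = (\<Sum>a\<in>{0..<int q}. gauss_sum a * (\<Sum>n\<in>{0..<int q}. cnj (chi n) * unity_root q (- a * n)))"
    unfolding of_real_sum complex_norm_square
    by (simp add: gauss_sum_def cnj_unity_root)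
  also have "\<dots> = (\<Sum>n\<in>{0..<int q}. \<Sum>a\<in>{0..<int q}. gauss_sum a * (cnj (chi n) * unity_root q (- a * n)))"
    unfolding sum_distrib_left by (rule sum.swap)
  also have "\<dots> = (\<Sum>n\<in>{0..<int q}. cnj (chi n) * (\<Sum>a\<in>{0..<int q}. gauss_sum a * unity_root q (- a * n)))"
    unfolding sum_distrib_left by (intro sum.cong refl) (simp add: mult_ac)
  also have "\<dots> = complex_of_real (real q * (\<Sum>n\<in>{0..<int q}. (norm (chi n))\<^sup>2))"
    unfolding gauss_sum_inversion of_real_mult of_real_sum complex_norm_square sum_distrib_left
    by (intro sum.cong refl) (simp add: mult_ac)
  finally show ?thesis by (simp only: of_real_eq_iff)
qed

end

locale primitive_char = dirichlet_char +
  assumes prim: "primitive_character q chi"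
begin

text \<open>Put \<open>d = q / gcd a q\<close>, a proper divisor of \<open>q\<close>. Primitivity
  gives a unit \<open>b\<close> congruent to 1 modulo \<open>d\<close> with
  \<open>chi b \<noteq> 1\<close>; since \<open>a * b\<close> is congruent to \<open>a\<close>
  modulo \<open>q\<close>, the Gauss sum equals \<open>chi b\<close> times itself.\<close>

lemma gauss_sum_eq_0:
  assumes "\<not> coprime a (int q)"
  shows "gauss_sum a = 0"
proof -
  define g where "g = gcd a (int q)"
  have "g > 1"
    using assms q_gt_1 gcd_pos_int[of a "int q"] unfolding g_def coprime_iff_gcd_eq_1 by linarith
  obtain z where z: "int q = g * z"
    unfolding g_def by (meson gcd_dvd2 dvdE)
  then have "z > 0"
    using \<open>g > 1\<close> q_gt_1 by (smt (verit) of_nat_0_less_iff zero_less_mult_pos zero_less_one less_trans)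
  define d where "d = nat z"
  have gd: "int q = g * int d"
    using z \<open>z > 0\<close> by (simp add: d_def)
  then have "d dvd q" by (metis dvd_triv_right int_dvd_int_iff)
  have "2 * int d \<le> g * int d"
    using \<open>g > 1\<close> by (intro mult_right_mono) auto
  moreover have "d > 0" using \<open>z > 0\<close> by (simp add: d_def)
  ultimately have "d < q" using gd by linarith
  then have "\<not> induced_from q chi d"
    using prim by (simp add: primitive_character_def)
  then obtain b where b: "[b = 1] (mod int d)" "coprime b (int q)" "chi b \<noteq> 1"
    using induced_fromI[OF \<open>d dvd q\<close>] by blast
  have "[a * b = a] (mod int q)"
  proof -
    obtain c where "a = g * c" unfolding g_def by (meson gcd_dvd1 dvdE)
    moreover have "int d dvd b - 1" using b(1) by (simp add: cong_iff_dvd_diff)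
    ultimately have "int q dvd a * (b - 1)"
      unfolding gd by (simp add: mult_dvd_mono mult.assoc)
    then show ?thesis by (simp add: cong_iff_dvd_diff algebra_simps)
  qed
  then have "[a * b * n = a * n] (mod int q)" for n
    by (intro cong_mult cong_refl)
  then have "unity_root q (a * b * n) = unity_root q (a * n)" for n
    using q_gt_1 by (intro unity_root_cong) auto
  then have "gauss_sum (a * b) = gauss_sum a"
    by (simp add: gauss_sum_def)
  then have "gauss_sum a = chi b * gauss_sum a"
    using gauss_sum_reindex[OF b(2), of a] by simp
  then show ?thesis using b(3) by simp
qed

lemma norm_gauss_sum_coprime:
  assumes "coprime a (int q)"
  shows "norm (gauss_sum a) = norm (gauss_sum 1)"
proof -
  have "norm (gauss_sum 1) = norm (chi a * gauss_sum (1 * a))"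
    by (rule arg_cong[OF gauss_sum_reindex[OF assms]])
  then show ?thesis by (simp add: norm_mult norm_chi[OF assms])
qed

text \<open>In Parseval's identity both sides live on the units \<open>P\<close>, where the Gauss
  sums share one absolute value; cancelling \<open>card P\<close> shows that its square is
  \<open>q\<close>.\<close>

lemma norm_gauss_sum_le: "norm (gauss_sum a) \<le> sqrt (real q)"
proof (cases "coprime a (int q)")
  case True
  define P where "P = {b \<in> {0..<int q}. coprime b (int q)}"
  have "finite P" unfolding P_def by (rule finite_subset[of _ "{0..<int q}"]) auto
  moreover have "1 \<in> P" using q_gt_1 by (simp add: P_def)
  ultimately have card: "card P > 0" by (auto simp: card_gt_0_iff)
  have "(\<Sum>b\<in>{0..<int q}. (norm (gauss_sum b))\<^sup>2) = (\<Sum>b\<in>P. (norm (gauss_sum 1))\<^sup>2)"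
  proof (rule sum.mono_neutral_cong_right)
    show "(norm (gauss_sum b))\<^sup>2 = (norm (gauss_sum 1))\<^sup>2" if "b \<in> P" for b
      using norm_gauss_sum_coprime[of b] that by (simp add: P_def)
  qed (auto simp: P_def gauss_sum_eq_0)
  moreover have "(\<Sum>b\<in>{0..<int q}. (norm (chi b))\<^sup>2) = (\<Sum>b\<in>P. 1)"
    by (rule sum.mono_neutral_cong_right) (auto simp: P_def chi_eq_0_iff norm_chi)
  ultimately have "(norm (gauss_sum 1))\<^sup>2 = real q"
    using sum_norm_gauss_sum card by simp
  then have "norm (gauss_sum 1) = sqrt (real q)"
    by (metis norm_ge_zero real_sqrt_unique)
  then show ?thesis using norm_gauss_sum_coprime[OF True] by simp
qed (simp add: gauss_sum_eq_0)

text \<open>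
  Expanding \<open>chi\<close> in Gauss sums turns the double sum into a sum of Fejer kernels, which are
  nonnegative, so that Parseval applies and no logarithm is lost as in Polya-Vinogradov.
\<close>

lemma norm_double_sum_le:
  "norm (\<Sum>j<N. \<Sum>k<N. chi (int j - int k)) \<le> sqrt (real q) * real N"
proof -
  define K where "K a = (\<Sum>j<N. unity_root q (a * int j))" for a
  have KK: "cnj (K a) * K a = (\<Sum>j<N. \<Sum>k<N. unity_root q (- a * (int j - int k)))" for a
  proof -
    have cnj_K: "cnj (K a) = (\<Sum>j<N. unity_root q (- a * int j))"
      by (simp add: K_def cnj_unity_root)
    show ?thesis
      unfolding cnj_K unfolding K_def sum_product
      by (simp add: unity_root_add[symmetric] algebra_simps)
  qed
  have "of_nat q * (\<Sum>j<N. \<Sum>k<N. chi (int j - int k))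
      = (\<Sum>j<N. \<Sum>k<N. \<Sum>a\<in>{0..<int q}. gauss_sum a * unity_root q (- a * (int j - int k)))"
    unfolding gauss_sum_inversion by (simp add: sum_distrib_left)
  also have "\<dots> = (\<Sum>j<N. \<Sum>a\<in>{0..<int q}. \<Sum>k<N. gauss_sum a * unity_root q (- a * (int j - int k)))"
    by (intro sum.cong refl sum.swap)
  also have "\<dots> = (\<Sum>a\<in>{0..<int q}. \<Sum>j<N. \<Sum>k<N. gauss_sum a * unity_root q (- a * (int j - int k)))"
    by (rule sum.swap)
  also have "\<dots> = (\<Sum>a\<in>{0..<int q}. gauss_sum a * (cnj (K a) * K a))"
    by (simp only: KK sum_distrib_left)
  \<comment> \<open>The frequency \<open>a = 0\<close> has to go, because \<open>K 0 = N\<close>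
    would spoil the bound; its Gauss sum vanishes since 0 is not a unit.\<close>
  also have "\<dots> = (\<Sum>a\<in>{1..<int q}. gauss_sum a * (cnj (K a) * K a))"
  proof (rule sum.mono_neutral_right)
    show "\<forall>i\<in>{0..<int q} - {1..<int q}. gauss_sum i * (cnj (K i) * K i) = 0"
    proof
      fix i assume "i \<in> {0..<int q} - {1..<int q}"
      then have "i = 0" by auto
      then show "gauss_sum i * (cnj (K i) * K i) = 0"
        using q_gt_1 by (simp add: gauss_sum_eq_0)
    qed
  qed auto
  finally have "norm (of_nat q * (\<Sum>j<N. \<Sum>k<N. chi (int j - int k)))
      = norm (\<Sum>a\<in>{1..<int q}. gauss_sum a * (cnj (K a) * K a))"
    by (rule arg_cong)
  then have "real q * norm (\<Sum>j<N. \<Sum>k<N. chi (int j - int k))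
      = norm (\<Sum>a\<in>{1..<int q}. gauss_sum a * (cnj (K a) * K a))"
    by (simp add: norm_mult)
  also have "\<dots> \<le> (\<Sum>a\<in>{1..<int q}. sqrt (real q) * (norm (K a))\<^sup>2)"
    by (intro sum_norm_le)
      (auto simp: norm_mult power2_eq_square intro!: mult_right_mono norm_gauss_sum_le)
  also have "\<dots> \<le> sqrt (real q) * (real q * real N)"
    unfolding sum_distrib_left[symmetric] K_def
    using q_gt_1 by (intro mult_left_mono sum_norm_square_geometric_unity_root) auto
  finally show ?thesis using q_gt_1 by (simp add: mult.left_commute)
qed

text \<open>Enlarging the square of pairs \<open>(j, k)\<close> by one adds a row and a column,
  which by evenness are equal to the same partial sum, and a diagonal term
  \<open>chi 0 = 0\<close>.\<close>

lemma norm_sum_sum_le: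
  assumes "even_character chi"
  shows "norm (\<Sum>m<N. \<Sum>k=1..m. chi (int k)) \<le> sqrt (real q) / 2 * real N"
proof -
  have even: "chi (- a) = chi a" for a
    using assms chi_mult[of "-1" a] by (simp add: even_character_def)
  have even': "chi (a - b) = chi (b - a)" for a b
    using even[of "b - a"] by simp
  have "(\<Sum>j<M. \<Sum>k<M. chi (int j - int k)) = 2 * (\<Sum>m<M. \<Sum>k=1..m. chi (int k))" for M
  proof (induction M)
    case (Suc M)
    have 1: "(\<Sum>k<M. chi (int M - int k)) = (\<Sum>k=1..M. chi (int k))"
      by (rule sum.reindex_bij_witness[of _ "\<lambda>k. M - k" "\<lambda>k. M - k"]) (auto simp: of_nat_diff)
    have 2: "(\<Sum>j<M. chi (int j - int M)) = (\<Sum>k=1..M. chi (int k))"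
      unfolding 1[symmetric] by (intro sum.cong refl even')
    show ?case
      using Suc 1 2 by (simp add: sum.distrib chi_0)
  qed simp
  then have "2 * norm (\<Sum>m<N. \<Sum>k=1..m. chi (int k)) \<le> sqrt (real q) * real N"
    using norm_double_sum_le[of N] by (simp add: norm_mult)
  then show ?thesis by simp
qed

text \<open>A full period sums to \<open>gauss_sum 0 = 0\<close>, so periods can be stripped until
  fewer than \<open>q\<close> terms remain. This crude bound serves convergence and boundary terms
  that vanish in the limit.\<close>

lemma norm_sum_le: "norm (\<Sum>k=1..N. chi (int k)) \<le> real q"
proof (induction N rule: less_induct)
  case (less N)
  show ?case
  proof (cases "N < q")
    case True
    have "norm (\<Sum>k=1..N. chi (int k)) \<le> (\<Sum>k=1..N. 1)"
      by (intro sum_norm_le norm_chi_le)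
    then show ?thesis using True by simp
  next
    case False
    then obtain M where M: "N = q + M" using le_Suc_ex by (meson not_less)
    have "(\<Sum>k=1..q. chi (int k)) = (\<Sum>k<q. chi (int k))"
    proof -
      have "(\<Sum>k=1..q. chi (int k)) = (\<Sum>k=1..<q. chi (int k)) + chi (int q)"
        using q_gt_1 by (simp add: sum.last_plus atLeastLessThanSuc_atLeastAtMost[symmetric])
      also have "chi (int q) = chi 0" by (intro chi_cong) (simp add: cong_def)
      also have "(\<Sum>k=1..<q. chi (int k)) + chi 0 = (\<Sum>k<q. chi (int k))"
        using q_gt_1 by (simp add: lessThan_atLeast0 sum.atLeast_Suc_lessThan)
      finally show ?thesis .
    qed
    also have "\<dots> = gauss_sum 0" by (simp add: gauss_sum_def sum_residues_nat)
    also have "\<dots> = 0" using q_gt_1 by (intro gauss_sum_eq_0) simp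
    finally have full: "(\<Sum>k=1..q. chi (int k)) = 0" .
    have "(\<Sum>k=1..N. chi (int k)) = (\<Sum>k=1..q. chi (int k)) + (\<Sum>k=q+1..q+M. chi (int k))"
      unfolding M by (rule sum.ub_add_nat) simp
    also have "\<dots> = (\<Sum>k=q+1..q+M. chi (int k))"
      unfolding full by simp
    also have "\<dots> = (\<Sum>k=1..M. chi (int (k + q)))"
      using sum.shift_bounds_cl_nat_ivl[of "\<lambda>k. chi (int k)" 1 q M] by (simp add: add.commute)
    also have "\<dots> = (\<Sum>k=1..M. chi (int k))"
      by (intro sum.cong refl chi_cong) (simp add: cong_def)
    finally show ?thesis using less[of M] M q_gt_1 by simp
  qed
qed

end

section \<open>Differentiation of Dirichlet series\<close>

lemma sum_by_parts:
  fixes c b :: "nat \<Rightarrow> 'a::comm_ring"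
  shows "(\<Sum>n<N. c n * b n)
    = (\<Sum>k<N. c k) * b N + (\<Sum>n<N. (\<Sum>k<Suc n. c k) * (b n - b (Suc n)))"
  by (induction N) (simp_all add: algebra_simps)

text \<open>Mean value inequality along the real segment between the two bases, which avoids the
  branch cut.\<close>

lemma norm_powr_diff_le:
  fixes s :: complex
  assumes "0 < Re s"
  shows "norm (of_nat (Suc n) powr - s - of_nat (Suc (Suc n)) powr - s)
    \<le> norm s * real (Suc n) powr (- Re s - 1)"
proof -
  define I where "I = complex_of_real ` {real (Suc n)..real (Suc (Suc n))}"
  have "norm (complex_of_real (real (Suc n)) powr - s - complex_of_real (real (Suc (Suc n))) powr - s)
    \<le> (norm s * real (Suc n) powr (- Re s - 1))
        * norm (complex_of_real (real (Suc n)) - complex_of_real (real (Suc (Suc n))))"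
  proof (rule field_differentiable_bound[where S = I])
    show "convex I"
      unfolding I_def by (intro convex_linear_image) (auto intro: bounded_linear.linear bounded_linear_of_real)
    fix z assume "z \<in> I"
    then obtain x where x: "z = complex_of_real x" "real (Suc n) \<le> x" by (auto simp: I_def)
    then have pos: "0 < x" by simp
    then have "z \<notin> \<real>\<^sub>\<le>\<^sub>0" using x by (auto simp: complex_nonpos_Reals_iff)
    then show "((\<lambda>z. z powr - s) has_field_derivative - s * z powr (- s - 1)) (at z within I)"
      by (rule has_field_derivative_at_within[OF has_field_derivative_powr])
    have "norm (- s * z powr (- s - 1)) = norm s * x powr (- Re s - 1)"
      using x pos by (simp add: norm_mult norm_powr_real_powr)
    also have "\<dots> \<le> norm s * real (Suc n) powr (- Re s - 1)"
      using x assms by (intro mult_left_mono powr_mono2') auto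
    finally show "norm (- s * z powr (- s - 1)) \<le> norm s * real (Suc n) powr (- Re s - 1)" .
  next
    show "complex_of_real (real (Suc n)) \<in> I" "complex_of_real (real (Suc (Suc n))) \<in> I"
      unfolding I_def by (intro imageI; simp)+
  qed
  then show ?thesis by (simp add: norm_minus_commute)
qed

text \<open>Summation by parts replaces the conditionally convergent series by one with terms of
  order \<open>n powr (- \<delta> - 1)\<close>, to which the Weierstrass test applies, plus a
  boundary term that tends to 0 uniformly.\<close>

lemma uniform_limit_dirichlet_series:
  fixes c :: "nat \<Rightarrow> complex"
  assumes B: "\<And>n. norm (\<Sum>k<n. c k) \<le> B" and "0 < \<delta>"
  shows "uniform_limit {s. \<delta> \<le> Re s \<and> norm s \<le> R}
    (\<lambda>N s. \<Sum>n<N. c n * of_nat (Suc n) powr - s) (\<lambda>s. \<Sum>n. c n * of_nat (Suc n) powr - s) sequentially"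
    (is "uniform_limit ?S ?f ?g sequentially")
proof -
  have "0 \<le> B" using B[of 0] by simp
  define h where "h n s = (\<Sum>k<Suc n. c k) * (of_nat (Suc n) powr - s - of_nat (Suc (Suc n)) powr - s)"
    for n and s :: complex
  have "uniform_limit ?S (\<lambda>N s. \<Sum>n<N. h n s) (\<lambda>s. \<Sum>n. h n s) sequentially"
  proof (rule Weierstrass_m_test)
    fix n s assume s: "s \<in> ?S"
    have "norm (h n s) \<le> B * (norm s * real (Suc n) powr (- Re s - 1))"
      unfolding h_def norm_mult using s \<open>0 < \<delta>\<close> \<open>0 \<le> B\<close>
      by (intro mult_mono B norm_powr_diff_le) auto
    also have "\<dots> \<le> B * (R * real (Suc n) powr (- \<delta> - 1))"
      using s \<open>0 \<le> B\<close> by (intro mult_left_mono mult_mono powr_mono) (auto intro: order_trans[OF norm_ge_zero])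
    finally show "norm (h n s) \<le> B * (R * real (Suc n) powr (- \<delta> - 1))" .
  next
    have "summable (\<lambda>n. real n powr (- \<delta> - 1))"
      using \<open>0 < \<delta>\<close> by (simp add: summable_real_powr_iff)
    then have "summable (\<lambda>n. real (Suc n) powr (- \<delta> - 1))"
      by (subst summable_Suc_iff)
    then show "summable (\<lambda>n. B * (R * real (Suc n) powr (- \<delta> - 1)))"
      by (intro summable_mult)
  qed
  moreover have "uniform_limit ?S (\<lambda>N s. (\<Sum>k<N. c k) * of_nat (Suc N) powr - s) (\<lambda>s. 0) sequentially"
  proof (rule uniform_limit_null_comparison)
    show "\<forall>\<^sub>F N in sequentially. \<forall>s\<in>?S. norm ((\<Sum>k<N. c k) * of_nat (Suc N) powr - s) \<le> B * real (Suc N) powr - \<delta>"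
    proof (intro always_eventually allI ballI)
      fix N s assume s: "s \<in> ?S"
      have "norm (of_nat (Suc N) powr - s) = real (Suc N) powr - Re s"
        using norm_powr_real_powr[of "of_nat (Suc N)" "- s"] by (simp del: of_nat_Suc)
      also have "\<dots> \<le> real (Suc N) powr - \<delta>" using s by (intro powr_mono) auto
      finally show "norm ((\<Sum>k<N. c k) * of_nat (Suc N) powr - s) \<le> B * real (Suc N) powr - \<delta>"
        unfolding norm_mult using \<open>0 \<le> B\<close> by (intro mult_mono B) auto
    qed
    have "(\<lambda>N. B * real N powr - \<delta>) \<longlonglongrightarrow> B * 0"
      using \<open>0 < \<delta>\<close> by (intro tendsto_mult tendsto_const tendsto_neg_powr filterlim_real_sequentially) auto
    then have "(\<lambda>N. B * real (Suc N) powr - \<delta>) \<longlonglongrightarrow> 0"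
      by (intro LIMSEQ_Suc) simp
    then show "uniform_limit ?S (\<lambda>N s. B * real (Suc N) powr - \<delta>) (\<lambda>s. 0) sequentially"
      unfolding uniform_limit_iff tendsto_iff by (auto elim!: eventually_mono)
  qed
  ultimately have "uniform_limit ?S (\<lambda>N s. (\<Sum>k<N. c k) * of_nat (Suc N) powr - s + (\<Sum>n<N. h n s))
      (\<lambda>s. 0 + (\<Sum>n. h n s)) sequentially"
    by (intro uniform_limit_add)
  moreover have "?f = (\<lambda>N s. (\<Sum>k<N. c k) * of_nat (Suc N) powr - s + (\<Sum>n<N. h n s))"
    unfolding h_def by (intro ext sum_by_parts)
  ultimately have lim: "uniform_limit ?S ?f (\<lambda>s. 0 + (\<Sum>n. h n s)) sequentially"
    by (simp only:)
  show ?thesis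
  proof (rule uniform_limit_cong[THEN iffD1, OF _ _ lim])
    show "0 + (\<Sum>n. h n s) = ?g s" if "s \<in> ?S" for s
      using tendsto_uniform_limitI[OF lim that] by (simp add: sums_def[symmetric] sums_iff)
  qed auto
qed

text \<open>Locally uniform limits of holomorphic functions may be differentiated termwise.\<close>

lemma dirichlet_series_deriv_tendsto:
  fixes c :: "nat \<Rightarrow> complex"
  assumes B: "\<And>n. norm (\<Sum>k<n. c k) \<le> B" and s: "0 < Re s"
  shows "(\<lambda>N. \<Sum>n<N. c n * (- of_real (ln (real (Suc n))) * of_nat (Suc n) powr - s))
    \<longlonglongrightarrow> deriv (\<lambda>s. \<Sum>n. c n * of_nat (Suc n) powr - s) s"
proof -
  let ?g = "\<lambda>s. \<Sum>n. c n * of_nat (Suc n) powr - s"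
  let ?f' = "\<lambda>N s. \<Sum>n<N. c n * (- of_real (ln (real (Suc n))) * of_nat (Suc n) powr - s)"
  have "\<exists>g'. \<forall>s\<in>{s. 0 < Re s}. (?g has_field_derivative g' s) (at s) \<and> (\<lambda>N. ?f' N s) \<longlonglongrightarrow> g' s"
  proof (rule has_complex_derivative_uniform_sequence)
    show "open {s. 0 < Re s}" by (rule open_halfspace_Re_gt)
    show "((\<lambda>s. \<Sum>n<N. c n * of_nat (Suc n) powr - s) has_field_derivative ?f' N s) (at s)" for N s
    proof -
      have "((\<lambda>s. of_nat (Suc n) powr - s) has_field_derivative
          - of_real (ln (real (Suc n))) * of_nat (Suc n) powr - s) (at s)" for n
      proof -
        have "of_nat (Suc n) \<noteq> (0 :: complex)" by (simp del: of_nat_Suc)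
        then have "((\<lambda>s. of_nat (Suc n) powr - s) has_field_derivative
            (Ln (of_nat (Suc n)) * of_nat (Suc n) powr - s) * (- 1)) (at s)"
          by (intro DERIV_chain2[OF has_field_derivative_powr_right]) (auto intro!: derivative_eq_intros)
        moreover have "Ln (of_nat (Suc n)) = of_real (ln (real (Suc n)))"
          using Ln_of_real[of "real (Suc n)"] by (simp del: of_nat_Suc)
        ultimately show ?thesis by simp
      qed
      then show ?thesis by (intro DERIV_sum DERIV_cmult)
    qed
    fix s assume "s \<in> {s. 0 < Re s}"
    then have pos: "0 < Re s" by simp
    define d where "d = Re s / 2"
    have sub: "cball s d \<subseteq> {z. d \<le> Re z \<and> norm z \<le> norm s + d}"
    proof
      fix z assume "z \<in> cball s d"
      then have "norm (s - z) \<le> d" by (simp add: dist_norm)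
      moreover have "Re (s - z) \<le> norm (s - z)" by (rule complex_Re_le_cmod)
      moreover have "norm z \<le> norm s + norm (s - z)" by (metis norm_minus_commute norm_triangle_sub)
      ultimately show "z \<in> {z. d \<le> Re z \<and> norm z \<le> norm s + d}"
        by (simp add: d_def)
    qed
    show "\<exists>d. 0 < d \<and> cball s d \<subseteq> {s. 0 < Re s} \<and>
        uniform_limit (cball s d) (\<lambda>N s. \<Sum>n<N. c n * of_nat (Suc n) powr - s) ?g sequentially"
    proof (intro exI[of _ d] conjI)
      show "0 < d" using pos by (simp add: d_def)
      then show "cball s d \<subseteq> {s. 0 < Re s}" using sub by force
      show "uniform_limit (cball s d) (\<lambda>N s. \<Sum>n<N. c n * of_nat (Suc n) powr - s) ?g sequentially"
        using uniform_limit_on_subset[OF uniform_limit_dirichlet_series[OF B \<open>0 < d\<close>] sub] .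
    qed
  qed
  then show ?thesis using s DERIV_imp_deriv by fastforce
qed

section \<open>Sums with convex weights\<close>

text \<open>Two summations by parts move the second differences onto \<open>g\<close>; convexity
  makes them nonnegative, so the linear bound on the double partial sums can be inserted termwise
  and the result telescopes.\<close>

lemma norm_sum_convex_weight_le:
  fixes c :: "nat \<Rightarrow> complex" and g :: "nat \<Rightarrow> real"
  assumes V: "\<And>M. norm (\<Sum>m<M. \<Sum>k=1..m. c k) \<le> K * real M"
    and nonneg: "\<And>n. 1 \<le> n \<Longrightarrow> 0 \<le> g n"
    and decr: "\<And>n. 1 \<le> n \<Longrightarrow> g (Suc n) \<le> g n"
    and conv: "\<And>n. 1 \<le> n \<Longrightarrow> g (Suc n) - g (Suc (Suc n)) \<le> g n - g (Suc n)"
  shows "norm (\<Sum>n=1..N. c n * of_real (g n))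
    \<le> norm (\<Sum>k=1..N. c k) * g (Suc N) + K * (2 * g 1 - g 2)"
proof -
  define S V' d where "S m = (\<Sum>k=1..m. c k)" and "V' M = (\<Sum>m<M. S m)" and "d n = g n - g (Suc n)"
    for m M n
  have V': "norm (V' M) \<le> K * real M" for M using V by (simp add: V'_def S_def)
  have "0 \<le> norm (V' 1)" by simp
  also have "\<dots> \<le> K" using V'[of 1] by simp
  finally have "0 \<le> K" .
  have d_nonneg: "0 \<le> d n" if "1 \<le> n" for n using decr[OF that] by (simp add: d_def)
  have d_decr: "0 \<le> d n - d (Suc n)" if "1 \<le> n" for n using conv[OF that] by (simp add: d_def)
  have "(\<Sum>n=1..N. c n * of_real (g n)) = S N * of_real (g (Suc N)) + V' (Suc N) * of_real (d (Suc N))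
      + (\<Sum>n=1..N. V' (Suc n) * of_real (d n - d (Suc n)))"
    by (induction N) (simp_all add: S_def V'_def d_def algebra_simps)
  also have "norm \<dots> \<le> norm (S N * of_real (g (Suc N))) + norm (V' (Suc N) * of_real (d (Suc N)))
      + (\<Sum>n=1..N. K * real (Suc n) * (d n - d (Suc n)))"
  proof (intro order_trans[OF norm_triangle_ineq] add_mono order_refl sum_norm_le)
    fix n assume "n \<in> {1..N}"
    then show "norm (V' (Suc n) * of_real (d n - d (Suc n))) \<le> K * real (Suc n) * (d n - d (Suc n))"
      unfolding norm_mult norm_of_real using d_decr[of n] V'[of "Suc n"] \<open>0 \<le> K\<close>
      by (intro mult_mono) auto
  qed
  also have "norm (S N * of_real (g (Suc N))) = norm (S N) * g (Suc N)"
    using nonneg[of "Suc N"] by (simp add: norm_mult)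
  also have "norm (V' (Suc N) * of_real (d (Suc N))) \<le> K * real (Suc N) * d (Suc N)"
    unfolding norm_mult norm_of_real using d_nonneg[of "Suc N"] V'[of "Suc N"] \<open>0 \<le> K\<close>
    by (intro mult_mono) auto
  \<comment> \<open>The factors \<open>Suc n\<close> start at 2, so the sum collapses to
    \<open>d 1 + (d 1 + ... + d N)\<close>.\<close>
  also have "norm (S N) * g (Suc N) + K * real (Suc N) * d (Suc N)
        + (\<Sum>n=1..N. K * real (Suc n) * (d n - d (Suc n)))
      = norm (S N) * g (Suc N) + K * (2 * g 1 - g 2 - g (Suc N))"
  proof -
    have "K * real (Suc N) * d (Suc N) + (\<Sum>n=1..N. K * real (Suc n) * (d n - d (Suc n)))
        = K * (2 * g 1 - g 2 - g (Suc N))"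
      by (induction N) (simp_all add: d_def numeral_2_eq_2 algebra_simps)
    then show ?thesis by simp
  qed
  also have "\<dots> \<le> norm (S N) * g (Suc N) + K * (2 * g 1 - g 2)"
    using nonneg[of "Suc N"] \<open>0 \<le> K\<close> by (simp add: mult_left_mono)
  finally show ?thesis by (simp add: S_def)
qed

section \<open>Monotonicity and convexity of the weight
  \<open>ln x * x powr - \<sigma>\<close>\<close>

definition ln_powr :: "real \<Rightarrow> real \<Rightarrow> real" where
  "ln_powr \<sigma> x = ln x * x powr - \<sigma>"

lemma ln_powr_nonneg: "1 \<le> x \<Longrightarrow> 0 \<le> ln_powr \<sigma> x"
  by (simp add: ln_powr_def)

lemma ln_powr_has_derivative:
  assumes "0 < x"
  shows "(ln_powr \<sigma> has_real_derivative (1 - \<sigma> * ln x) * x powr (- \<sigma> - 1)) (at x)"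
proof -
  have "x powr - \<sigma> = x * x powr (- \<sigma> - 1)"
    using powr_add[of x 1 "- \<sigma> - 1"] assms by simp
  then show ?thesis
    unfolding ln_powr_def using assms
    by (auto intro!: derivative_eq_intros simp: field_simps)
qed

lemma ln_powr_has_second_derivative:
  assumes "0 < x"
  shows "((\<lambda>x. (1 - \<sigma> * ln x) * x powr (- \<sigma> - 1)) has_real_derivative
    (\<sigma> * (\<sigma> + 1) * ln x - (2 * \<sigma> + 1)) * x powr (- \<sigma> - 2)) (at x)"
proof -
  have "x powr (- \<sigma> - 1) = x powr (1 + (- \<sigma> - 2))"
    by (rule arg_cong[of _ _ "(powr) x"]) simp
  also have "\<dots> = x * x powr (- \<sigma> - 2)"
    using assms by (subst powr_add) simp
  finally have "x powr (- \<sigma> - 1) = x * x powr (- \<sigma> - 2)" .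
  then show ?thesis
    using assms by (auto intro!: derivative_eq_intros simp: field_simps)
qed

text \<open>The value \<open>8 / 3\<close> is what the convexity proof requires at the extreme case
  \<open>\<sigma> = 1 / 2\<close>.\<close>

lemma ln_ge_of_ge_16:
  assumes "(16::real) \<le> x"
  shows "8 / 3 \<le> ln x"
proof -
  have "ln (2 ^ 4 :: real) = 4 * ln 2"
    by (subst ln_realpow) auto
  then have "8 / 3 \<le> ln (16 :: real)"
    using ln2_ge_two_thirds by simp
  also have "\<dots> \<le> ln x" using assms by simp
  finally show ?thesis .
qed

lemma ln_powr_antimono:
  assumes "1 / 2 \<le> \<sigma>" "16 \<le> x" "x \<le> y"
  shows "ln_powr \<sigma> y \<le> ln_powr \<sigma> x"
  using assms(3)
proof (rule DERIV_nonpos_imp_nonincreasing)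
  fix z assume z: "x \<le> z" "z \<le> y"
  then have "1 / 2 * (8 / 3) \<le> \<sigma> * ln z"
    using assms ln_ge_of_ge_16[of z] by (intro mult_mono) auto
  then have "(1 - \<sigma> * ln z) * z powr (- \<sigma> - 1) \<le> 0"
    by (intro mult_nonpos_nonneg) auto
  then show "\<exists>D. (ln_powr \<sigma> has_real_derivative D) (at z) \<and> D \<le> 0"
    using ln_powr_has_derivative[of z \<sigma>] assms z by auto
qed

lemma convex_on_ln_powr:
  assumes "1 / 2 \<le> \<sigma>"
  shows "convex_on {16..} (ln_powr \<sigma>)"
proof (rule f''_ge0_imp_convex)
  fix x :: real assume x: "x \<in> {16..}"
  then show "(ln_powr \<sigma> has_real_derivative (1 - \<sigma> * ln x) * x powr (- \<sigma> - 1)) (at x)"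
    by (intro ln_powr_has_derivative) simp
  show "((\<lambda>x. (1 - \<sigma> * ln x) * x powr (- \<sigma> - 1)) has_real_derivative
    (\<sigma> * (\<sigma> + 1) * ln x - (2 * \<sigma> + 1)) * x powr (- \<sigma> - 2)) (at x)"
    using x by (intro ln_powr_has_second_derivative) simp
  \<comment> \<open>The factored form of the second derivative's coefficient with
    \<open>ln x\<close> replaced by \<open>8 / 3\<close>.\<close>
  have "0 \<le> 8 / 3 * (\<sigma> - 1 / 2) * (\<sigma> + 3 / 4)"
    using assms by simp
  also have "\<dots> = \<sigma> * (\<sigma> + 1) * (8 / 3) - (2 * \<sigma> + 1)"
    by (simp add: field_simps)
  also have "\<dots> \<le> \<sigma> * (\<sigma> + 1) * ln x - (2 * \<sigma> + 1)"
    using assms x ln_ge_of_ge_16[of x] by (intro diff_right_mono mult_left_mono) auto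
  finally show "0 \<le> (\<sigma> * (\<sigma> + 1) * ln x - (2 * \<sigma> + 1)) * x powr (- \<sigma> - 2)"
    by simp
qed simp

lemma ln_powr_diff_antimono:
  assumes "1 / 2 \<le> \<sigma>" "16 \<le> n"
  shows "ln_powr \<sigma> (real (Suc n)) - ln_powr \<sigma> (real (Suc (Suc n)))
    \<le> ln_powr \<sigma> (real n) - ln_powr \<sigma> (real (Suc n))"
proof -
  have "ln_powr \<sigma> ((1 - 1 / 2) *\<^sub>R real n + (1 / 2) *\<^sub>R real (Suc (Suc n)))
    \<le> (1 - 1 / 2) * ln_powr \<sigma> (real n) + 1 / 2 * ln_powr \<sigma> (real (Suc (Suc n)))"
    using assms(2) by (intro convex_onD[OF convex_on_ln_powr[OF assms(1)]]) auto
  moreover have "(1 - 1 / 2) *\<^sub>R real n + (1 / 2) *\<^sub>R real (Suc (Suc n)) = real (Suc n)"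
    by (simp add: field_simps)
  ultimately show ?thesis by simp
qed

text \<open>\<open>ln x / x\<close> has antiderivative \<open>(ln x)\<^sup>2 / 2\<close> and
  decreases from \<open>exp 1\<close> on, so integral comparison works from 3 onwards; the constant
  2 absorbs the initial terms.\<close>

lemma sum_ln_div_le:
  assumes "3 \<le> N"
  shows "(\<Sum>n=1..N. ln (real n) / real n) \<le> (ln (real N))\<^sup>2 / 2 + 2"
  using assms
proof (induction N rule: dec_induct)
  case base
  have "ln (2::real) \<le> 1" "ln (3::real) \<le> 2"
    using ln_le_minus_one[of "2::real"] ln_le_minus_one[of "3::real"] by auto
  moreover have "(\<Sum>n=1..3. ln (real n) / real n) = ln 2 / 2 + ln 3 / 3"
    by (simp add: numeral_3_eq_3)
  ultimately have "(\<Sum>n=1..3. ln (real n) / real n) \<le> 2" by simp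
  then show ?case by (smt (verit) divide_nonneg_pos zero_le_power2)
next
  case (step N)
  define h where "h x = (ln x)\<^sup>2 / 2" for x :: real
  have deriv: "(h has_real_derivative ln x / x) (at x)" if "0 < x" for x
    unfolding h_def using that by (auto intro!: derivative_eq_intros)
  obtain z where z: "real N < z" "z < real (Suc N)"
    and hz: "h (real (Suc N)) - h (real N) = (real (Suc N) - real N) * (ln z / z)"
    using MVT2[of "real N" "real (Suc N)" h "\<lambda>x. ln x / x"] deriv step.hyps by force
  have "ln (real (Suc N)) / real (Suc N) \<le> ln z / z"
  proof (rule DERIV_nonpos_imp_nonincreasing[of z "real (Suc N)" "\<lambda>x. ln x / x"])
    fix x assume x: "z \<le> x" "x \<le> real (Suc N)"
    then have "3 \<le> x" using z step.hyps by simp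
    then have "exp 1 \<le> x" using exp_le by simp
    then have "1 \<le> ln x" using \<open>3 \<le> x\<close> by (subst ln_ge_iff) auto
    moreover have "((\<lambda>x. ln x / x) has_real_derivative (1 - ln x) / x\<^sup>2) (at x)"
      using \<open>3 \<le> x\<close> by (auto intro!: derivative_eq_intros simp: power2_eq_square field_simps)
    ultimately show "\<exists>y. ((\<lambda>x. ln x / x) has_real_derivative y) (at x) \<and> y \<le> 0"
      by (intro exI[of _ "(1 - ln x) / x\<^sup>2"]) (simp add: divide_nonpos_nonneg)
  qed (use z in simp)
  then have "ln (real (Suc N)) / real (Suc N) \<le> h (real (Suc N)) - h (real N)"
    using hz by simp
  then show ?case using step by (simp add: h_def)
qed

text \<open>Split \<open>f = (f - g) + g\<close>, where \<open>g\<close> is linear up to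
  \<open>A\<close>. The convex bound handles \<open>g\<close>; the head is estimated termwise, and
  there the subtracted sum of \<open>g\<close> outweighs the cost of the convex bound, which yields
  the saving \<open>2 / 5 * ln A\<close>.\<close>

lemma norm_sum_ln_powr_le:
  fixes c :: "nat \<Rightarrow> complex" and A N :: nat and Q \<sigma> :: real
  assumes c: "\<And>n. norm (c n) \<le> 1"
    and V: "\<And>M. norm (\<Sum>m<M. \<Sum>k=1..m. c k) \<le> Q / 2 * real M"
    and Q: "Q \<le> real A" and A: "615 \<le> A" "A \<le> N" and \<sigma>: "1 / 2 \<le> \<sigma>" "\<sigma> \<le> 1"
  shows "norm (\<Sum>n=1..N. c n * of_real (ln_powr \<sigma> (real n)))
    \<le> norm (\<Sum>k=1..N. c k) * ln_powr \<sigma> (real (Suc N))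
      + real A powr (1 - \<sigma>) * ((ln (real A))\<^sup>2 / 2 + 2 - 2 / 5 * ln (real A))"
proof -
  define f where "f n = ln_powr \<sigma> (real n)" for n
  define d where "d = f A - f (Suc A)"
  define g where "g n = (if n < A then f A + (real A - real n) * d else f n)" for n
  define E where "E = real A powr (1 - \<sigma>)"
  have f_nonneg: "0 \<le> f n" if "1 \<le> n" for n
    unfolding f_def using that by (intro ln_powr_nonneg) simp
  have fA: "f A = E * ln (real A) / real A"
    using A by (simp add: f_def E_def ln_powr_def powr_diff powr_minus field_simps)
  have d_nonneg: "0 \<le> d"
    unfolding d_def f_def using A \<sigma> ln_powr_antimono[of \<sigma> "real A" "real (Suc A)"] by simp
  \<comment> \<open>\<open>f x\<close> is the increasing function
    \<open>ln x * x powr (1 - \<sigma>)\<close> divided by \<open>x\<close>, so one step from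
    \<open>A\<close> shrinks it by a factor of at least \<open>A / (A + 1)\<close>.\<close>
  have Ad: "real A * d \<le> f A"
  proof -
    have "real (Suc A) powr - \<sigma> = real (Suc A) powr (1 - \<sigma>) / real (Suc A)"
      by (simp add: powr_diff powr_minus divide_inverse del: of_nat_Suc)
    moreover have "E \<le> real (Suc A) powr (1 - \<sigma>)"
      unfolding E_def using \<sigma> by (intro powr_mono2) auto
    ultimately have "E / real (Suc A) \<le> real (Suc A) powr - \<sigma>"
      by (simp add: divide_right_mono del: of_nat_Suc)
    then have "ln (real A) * (E / real (Suc A)) \<le> f (Suc A)"
      unfolding f_def ln_powr_def using A by (intro mult_mono) (auto simp: E_def)
    then have "f A * real A / real (Suc A) \<le> f (Suc A)"
      using A by (simp add: fA mult.commute)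
    then have "f A * real A \<le> f (Suc A) * (real A + 1)"
      by (simp add: field_simps)
    then have "real A * d \<le> f (Suc A)"
      by (simp add: d_def algebra_simps)
    then show ?thesis using d_nonneg by (simp add: d_def)
  qed
  \<comment> \<open>Beyond \<open>16\<close> the function \<open>f\<close> is convex, so it stays above its secant through \<open>A\<close> and \<open>A + 1\<close>.\<close>
  have tail: "d \<le> f n - f (Suc n) \<and> f A + (real A - real n) * d \<le> f n" if n: "16 \<le> n" "n \<le> A" for n
    using n(2)
  proof (induction rule: inc_induct)
    case base
    show ?case by (simp add: d_def)
  next
    case (step m)
    have "f (Suc m) - f (Suc (Suc m)) \<le> f m - f (Suc m)"
      unfolding f_def using \<sigma> n step.hyps by (intro ln_powr_diff_antimono) auto
    with step.IH show ?case by (auto simp: algebra_simps)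
  qed
  have g_step: "g n - g (Suc n) = (if n < A then d else f n - f (Suc n))" for n
  proof -
    consider "Suc n < A" | "Suc n = A" | "A \<le> n" by linarith
    then show ?thesis
      by cases (auto simp: g_def algebra_simps)
  qed
  have g_nonneg: "0 \<le> g n" if "1 \<le> n" for n
    using that d_nonneg f_nonneg A by (auto simp: g_def)
  have g_le: "g n \<le> 2 * f A" if "n < A" for n
  proof -
    have "(real A - real n) * d \<le> real A * d" using d_nonneg by (intro mult_right_mono) auto
    then show ?thesis using that Ad by (simp add: g_def)
  qed
  have "norm (\<Sum>n=1..N. c n * of_real (g n))
    \<le> norm (\<Sum>k=1..N. c k) * g (Suc N) + Q / 2 * (2 * g 1 - g 2)"
  proof (rule norm_sum_convex_weight_le[OF V g_nonneg])
    fix n :: nat assume "1 \<le> n"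
    show "g (Suc n) \<le> g n"
    proof (cases "n < A")
      case True
      then show ?thesis using g_step[of n] d_nonneg by simp
    next
      case False
      then have "f (Suc n) \<le> f n"
        unfolding f_def using A \<sigma> by (intro ln_powr_antimono) auto
      then show ?thesis using g_step[of n] False by simp
    qed
    \<comment> \<open>Since \<open>d\<close> is the forward difference of \<open>f\<close> at
      \<open>A\<close>, the differences of \<open>g\<close> agree across the junction and convexity
      survives.\<close>
    show "g (Suc n) - g (Suc (Suc n)) \<le> g n - g (Suc n)"
    proof -
      consider "Suc n < A" | "Suc n = A" | "A \<le> n" by linarith
      then show ?thesis
      proof cases
        case 3
        then show ?thesis
          unfolding g_step using A \<sigma> ln_powr_diff_antimono[of \<sigma> n] by (simp add: f_def)
      qed (auto simp: g_step d_def)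
    qed
  qed
  also have "g (Suc N) = ln_powr \<sigma> (real (Suc N))"
    using A by (simp add: g_def f_def)
  \<comment> \<open>This is the linear piece of \<open>g\<close> extrapolated to 0.\<close>
  also have "2 * g 1 - g 2 = f A + real A * d"
    using A by (simp add: g_def algebra_simps)
  also have "Q / 2 * (f A + real A * d) \<le> real A / 2 * (f A + real A * d)"
    using Q d_nonneg f_nonneg[of A] A by (intro mult_right_mono) auto
  finally have smooth: "norm (\<Sum>n=1..N. c n * of_real (g n))
    \<le> norm (\<Sum>k=1..N. c k) * ln_powr \<sigma> (real (Suc N)) + real A / 2 * (f A + real A * d)"
    by simp

  have "norm (\<Sum>n=1..N. c n * of_real (f n - g n)) \<le> (\<Sum>n=1..N. \<bar>f n - g n\<bar>)"
  proof (rule sum_norm_le)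
    show "norm (c n * of_real (f n - g n)) \<le> \<bar>f n - g n\<bar>" for n
      unfolding norm_mult norm_of_real using c[of n] by (intro mult_left_le_one_le) auto
  qed
  also have "\<dots> = (\<Sum>n\<in>{1..<A}. \<bar>f n - g n\<bar>)"
    using A by (intro sum.mono_neutral_right) (auto simp: g_def)
  \<comment> \<open>From 16 on \<open>f\<close> dominates \<open>g\<close>. Below 16 the sign is
    unknown, and dropping the absolute value costs at most \<open>2 * g n \<le> 4 * f A\<close> for
    each of 15 indices.\<close>
  also have "\<dots> \<le> (\<Sum>n\<in>{1..<A}. f n - g n + (if n \<in> {1..<16} then 4 * f A else 0))"
  proof (rule sum_mono)
    fix n assume n: "n \<in> {1..<A}"
    show "\<bar>f n - g n\<bar> \<le> f n - g n + (if n \<in> {1..<16} then 4 * f A else 0)"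
    proof (cases "n < 16")
      case True
      then show ?thesis using n f_nonneg[of n] g_nonneg[of n] g_le[of n] by auto
    next
      case False
      then show ?thesis using n tail[of n] by (simp add: g_def)
    qed
  qed
  also have "\<dots> = (\<Sum>n\<in>{1..<A}. f n) - (\<Sum>n\<in>{1..<A}. g n)
      + (\<Sum>n\<in>{1..<A}. if n \<in> {1..<16} then 4 * f A else 0)"
    by (simp add: sum.distrib sum_subtractf)
  also have "(\<Sum>n\<in>{1..<A}. if n \<in> {1..<16} then 4 * f A else 0) = (\<Sum>n\<in>{1..<16::nat}. 4 * f A)"
    using A by (intro sum.mono_neutral_cong_right) auto
  also have "\<dots> = 60 * f A" by simp
  also have "(\<Sum>n\<in>{1..<A}. g n) = (real A - 1) * f A + d * (real A * (real A - 1) / 2)"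
  proof -
    have *: "(\<Sum>n\<in>{1..<M}. x + (y - real n) * d)
        = (real M - 1) * (x + y * d) - d * (real M * (real M - 1) / 2)" if "1 \<le> M" for M x y
      using that by (induction M rule: dec_induct) (simp_all add: field_simps)
    have "(\<Sum>n\<in>{1..<A}. g n) = (\<Sum>n\<in>{1..<A}. f A + (real A - real n) * d)"
      by (intro sum.cong) (auto simp: g_def)
    also have "\<dots> = (real A - 1) * (f A + real A * d) - d * (real A * (real A - 1) / 2)"
      using A by (intro *) simp
    finally show ?thesis by (simp add: field_simps)
  qed
  also have "(\<Sum>n\<in>{1..<A}. f n) \<le> E * ((ln (real A))\<^sup>2 / 2 + 2)"
  proof -
    have "(\<Sum>n\<in>{1..<A}. f n) \<le> (\<Sum>n\<in>{1..<A}. E * (ln (real n) / real n))"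
    proof (rule sum_mono)
      fix n assume n: "n \<in> {1..<A}"
      then have "f n = real n powr (1 - \<sigma>) * (ln (real n) / real n)"
        by (simp add: f_def ln_powr_def powr_diff powr_minus field_simps)
      also have "\<dots> \<le> E * (ln (real n) / real n)"
        unfolding E_def using n \<sigma> by (intro mult_right_mono powr_mono2) auto
      finally show "f n \<le> E * (ln (real n) / real n)" .
    qed
    also have "\<dots> = E * (\<Sum>n\<in>{1..<A}. ln (real n) / real n)"
      by (simp add: sum_distrib_left)
    also have "\<dots> \<le> E * (\<Sum>n=1..A. ln (real n) / real n)"
      by (intro mult_left_mono sum_mono2) (auto simp: E_def)
    also have "\<dots> \<le> E * ((ln (real A))\<^sup>2 / 2 + 2)"
      using A by (intro mult_left_mono sum_ln_div_le) (auto simp: E_def)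
    finally show ?thesis .
  qed
  finally have head: "norm (\<Sum>n=1..N. c n * of_real (f n - g n))
      \<le> E * ((ln (real A))\<^sup>2 / 2 + 2) - ((real A - 1) * f A + d * (real A * (real A - 1) / 2)) + 60 * f A"
    by simp

  have "norm (\<Sum>n=1..N. c n * of_real (f n))
      = norm ((\<Sum>n=1..N. c n * of_real (f n - g n)) + (\<Sum>n=1..N. c n * of_real (g n)))"
    by (simp add: sum.distrib[symmetric] algebra_simps)
  also have "\<dots> \<le> norm (\<Sum>n=1..N. c n * of_real (f n - g n)) + norm (\<Sum>n=1..N. c n * of_real (g n))"
    by (rule norm_triangle_ineq)
  also have "\<dots> \<le> norm (\<Sum>k=1..N. c k) * ln_powr \<sigma> (real (Suc N))
      + (E * ((ln (real A))\<^sup>2 / 2 + 2) + (61 * f A + real A * d / 2 - real A / 2 * f A))"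
    using add_mono[OF head smooth] by (simp add: field_simps)
  \<comment> \<open>The terms \<open>A\<^sup>2 * d / 2\<close> of head and smooth part have
    cancelled. By \<open>Ad\<close> at most \<open>(61.5 - A / 2) * f A\<close> is left, and
    \<open>A \<ge> 615\<close> gives \<open>61.5 \<le> A / 10\<close>.\<close>
  also have "61 * f A + real A * d / 2 - real A / 2 * f A \<le> - (2 / 5 * (real A * f A))"
  proof -
    have "615 * f A \<le> real A * f A" using A f_nonneg[of A] by (intro mult_right_mono) auto
    then show ?thesis using Ad by simp
  qed
  also have "real A * f A = E * ln (real A)"
    using A by (simp add: fA)
  finally show ?thesis by (simp add: f_def E_def algebra_simps)
qed

text \<open>Here \<open>t = ln Q\<close>, \<open>L = ln A\<close> and
  \<open>exp x = A powr (1 - \<sigma>)\<close>. Rounding \<open>Q\<close> up to \<open>A\<close>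
  costs about \<open>t / 500\<close> and the exponential factor about \<open>t / 25\<close>, so of
  the saving \<open>2 / 5 * t\<close> there remains \<open>0.358 * t\<close>, which exceeds 2 once
  \<open>t \<ge> 6\<close>.\<close>

lemma main_term_le:
  fixes Q L t x :: real
  assumes "632 \<le> Q" "6 \<le> t" "0 \<le> L" "L \<le> t + 1 / Q" "0 \<le> x" "x \<le> 25 / (Q * t\<^sup>2) * L"
  shows "exp x * (L\<^sup>2 / 2 + 2 - 2 / 5 * L) \<le> t\<^sup>2 / 2"
proof -
  have "1 / Q \<le> 1 / 632" using assms(1) by (intro divide_left_mono) auto
  then have L: "L \<le> t + 1 / 500" using assms by linarith
  have "x \<le> 25 / (632 * t\<^sup>2) * (t + 1 / 500)"
  proof -
    have "25 / (Q * t\<^sup>2) \<le> 25 / (632 * t\<^sup>2)"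
      using assms by (intro divide_left_mono mult_right_mono mult_pos_pos) auto
    then have "25 / (Q * t\<^sup>2) * L \<le> 25 / (632 * t\<^sup>2) * (t + 1 / 500)"
      using assms L by (intro mult_mono) auto
    then show ?thesis using assms(6) by linarith
  qed
  \<comment> \<open>Uses that \<open>25 / 632\<close> is slightly below
    \<open>1 / 25\<close>.\<close>
  also have "\<dots> \<le> 1 / (25 * t)"
    using assms(2) by (simp add: field_simps power2_eq_square)
  finally have x: "x \<le> 1 / (25 * t)" .
  have "1 / (25 * t) \<le> 1" using assms(2) by simp
  with x have "x \<le> 1" by linarith
  have "exp x \<le> 1 + x + x\<^sup>2" using assms(5) \<open>x \<le> 1\<close> by (rule exp_bound)
  also have "x\<^sup>2 \<le> x" using assms(5) \<open>x \<le> 1\<close> by (simp add: power2_eq_square mult_left_le)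
  finally have E: "exp x \<le> 1 + 2 / (25 * t)" using x by simp
  have "(L\<^sup>2 / 2 + 2 - 2 / 5 * L) \<le> ((t + 1 / 500)\<^sup>2 / 2 + 2 - 2 / 5 * (t + 1 / 500))"
  proof -
    have "0 \<le> (t + 1 / 500 - L) * ((t + 1 / 500 + L) / 2 - 2 / 5)"
      using L assms by (intro mult_nonneg_nonneg) auto
    then show ?thesis by (simp add: power2_eq_square field_simps)
  qed
  also have "\<dots> \<le> t\<^sup>2 / 2 - (398 / 1000 * t - 2)"
    by (simp add: power2_eq_square field_simps)
  finally have M: "L\<^sup>2 / 2 + 2 - 2 / 5 * L \<le> t\<^sup>2 / 2 - (398 / 1000 * t - 2)" .
  have "0 \<le> (L - 2 / 5)\<^sup>2 / 2 + 48 / 25" by simp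
  then have pos: "0 \<le> L\<^sup>2 / 2 + 2 - 2 / 5 * L" by (simp add: power2_eq_square field_simps)
  have "exp x * (L\<^sup>2 / 2 + 2 - 2 / 5 * L) \<le> (1 + 2 / (25 * t)) * (t\<^sup>2 / 2 - (398 / 1000 * t - 2))"
    using E M pos assms(2) by (intro mult_mono) auto
  also have "\<dots> = t\<^sup>2 / 2 - (358 / 1000 * t - 2) + 2 / (25 * t) * (2 - 398 / 1000 * t)"
    using assms(2) by (simp add: power2_eq_square field_simps)
  also have "\<dots> \<le> t\<^sup>2 / 2"
  proof -
    have "2 / (25 * t) * (2 - 398 / 1000 * t) \<le> 0"
      using assms(2) by (intro mult_nonneg_nonpos) auto
    then show ?thesis using assms(2) by linarith
  qed
  finally show ?thesis .
qed

section \<open>Passage to the limit in the bound for the differentiated series\<close>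

theorem theorem1p1:
  fixes q :: nat and chi :: "int \<Rightarrow> complex" and \<beta>\<^sub>0 \<sigma> :: real
  assumes "q > 4 * 10 ^ 5"
    and "primitive_character q chi"
    and "even_character chi"
    and "real_character chi"
    and "\<beta>\<^sub>0 \<in> {0<..<1}"
    and "dirichlet_L chi (of_real \<beta>\<^sub>0) = 0"
    and "\<beta>\<^sub>0 \<ge> 1 - 100 / (sqrt (real q) * (ln (real q))\<^sup>2)"
    and "\<sigma> \<in> {\<beta>\<^sub>0<..<1}"
  shows "norm (deriv (dirichlet_L chi) (of_real \<sigma>)) \<le> 1 / 8 * (ln (real q))\<^sup>2"
proof -
  interpret primitive_char q chi
    using assms(1,2) by unfold_locales (auto simp: primitive_character_def)
  define Q t where "Q = sqrt (real q)" and "t = ln Q"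
  \<comment> \<open>The least integer that is at least \<open>Q\<close>, so that \<open>ln A\<close>
    exceeds \<open>t\<close> by at most \<open>1 / Q\<close>.\<close>
  define A where "A = nat \<lceil>Q\<rceil>"
  have "632 = sqrt (632\<^sup>2)" by (rule real_sqrt_unique[symmetric]) auto
  also have "\<dots> \<le> Q"
    unfolding Q_def using assms(1) by (intro real_sqrt_le_mono) simp
  finally have Q: "632 \<le> Q" .
  have ln_q: "ln (real q) = 2 * t"
    using assms(1) by (simp add: t_def Q_def ln_sqrt)
  have t: "6 \<le> t"
  proof -
    have "ln (2 ^ 9 :: real) = 9 * ln 2" by (subst ln_realpow) auto
    then have "6 \<le> ln (512 :: real)" using ln2_ge_two_thirds by simp
    also have "\<dots> \<le> t" unfolding t_def using Q by simp
    finally show ?thesis .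
  qed
  have A: "Q \<le> real A" "real A \<le> Q + 1"
    unfolding A_def using Q by linarith+
  have "615 \<le> A" using A(1) Q by linarith
  \<comment> \<open>\<open>\<sigma>\<close> lies between \<open>\<beta>\<^sub>0\<close> and 1, and
    \<open>ln q = 2 * t\<close> turns 100 into 25.\<close>
  have \<sigma>: "1 - \<sigma> \<le> 25 / (Q * t\<^sup>2)" "\<sigma> \<le> 1"
    using assms(7,8) by (auto simp: ln_q Q_def[symmetric] power_mult_distrib)
  have "25 / (Q * t\<^sup>2) \<le> 25 / (632 * 6\<^sup>2)"
    using Q t by (intro divide_left_mono mult_mono power_mono mult_pos_pos) auto
  then have \<sigma>_ge: "1 / 2 \<le> \<sigma>" using \<sigma>(1) by simp
  define B where "B = real A powr (1 - \<sigma>) * ((ln (real A))\<^sup>2 / 2 + 2 - 2 / 5 * ln (real A))"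
  have B: "B \<le> t\<^sup>2 / 2"
  proof -
    have "ln (real A) \<le> ln (Q * (1 + 1 / Q))"
      using A Q by (subst ln_le_cancel_iff) (auto simp: algebra_simps)
    also have "\<dots> = t + ln (1 + 1 / Q)"
      unfolding t_def using Q by (intro ln_mult_pos) (auto intro!: add_pos_pos)
    also have "ln (1 + 1 / Q) \<le> 1 / Q"
      using Q by (intro ln_add_one_self_le_self) simp
    finally have "ln (real A) \<le> t + 1 / Q" by simp
    moreover have "(1 - \<sigma>) * ln (real A) \<le> 25 / (Q * t\<^sup>2) * ln (real A)"
      using \<open>615 \<le> A\<close> by (intro mult_right_mono \<sigma>(1)) simp
    ultimately have "exp ((1 - \<sigma>) * ln (real A)) * ((ln (real A))\<^sup>2 / 2 + 2 - 2 / 5 * ln (real A)) \<le> t\<^sup>2 / 2"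
      using Q t \<sigma> \<open>615 \<le> A\<close> by (intro main_term_le[of Q]) auto
    then show ?thesis
      using \<open>615 \<le> A\<close> by (simp add: B_def powr_def)
  qed
  define D where "D N = (\<Sum>n<N. chi (int (Suc n)) * (- of_real (ln (real (Suc n))) * of_nat (Suc n) powr - of_real \<sigma>))" for N
  have "D \<longlonglongrightarrow> deriv (\<lambda>s. \<Sum>n. chi (int (Suc n)) * of_nat (Suc n) powr - s) (of_real \<sigma>)"
    unfolding D_def
  proof (rule dirichlet_series_deriv_tendsto)
    show "norm (\<Sum>k<n. chi (int (Suc k))) \<le> real q" for n
      using norm_sum_le[of n] by (simp add: sum.atLeast1_atMost_eq)
    show "0 < Re (of_real \<sigma>)" using \<sigma>_ge by simp
  qed
  then have "D \<longlonglongrightarrow> deriv (dirichlet_L chi) (of_real \<sigma>)"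
    by (simp add: dirichlet_L_def[abs_def])
  then have lim: "(\<lambda>N. norm (D N)) \<longlonglongrightarrow> norm (deriv (dirichlet_L chi) (of_real \<sigma>))"
    by (rule tendsto_norm)
  have bound: "norm (D N) \<le> real q * ln_powr \<sigma> (real (Suc N)) + B" if "A \<le> N" for N
  proof -
    have "D N = - (\<Sum>n=1..N. chi (int n) * of_real (ln_powr \<sigma> (real n)))"
      unfolding D_def One_nat_def sum.atLeast1_atMost_eq sum_negf[symmetric]
    proof (intro sum.cong refl)
      fix n
      have "of_nat (Suc n) powr - complex_of_real \<sigma> = of_real (real (Suc n) powr - \<sigma>)"
        using powr_of_real[of "real (Suc n)" "- \<sigma>"] by (simp del: of_nat_Suc)
      then show "chi (int (Suc n)) * (- of_real (ln (real (Suc n))) * of_nat (Suc n) powr - of_real \<sigma>)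
          = - (chi (int (Suc n)) * of_real (ln_powr \<sigma> (real (Suc n))))"
        by (simp add: ln_powr_def del: of_nat_Suc)
    qed
    then have "norm (D N) = norm (\<Sum>n=1..N. chi (int n) * of_real (ln_powr \<sigma> (real n)))"
      by simp
    also have "\<dots> \<le> norm (\<Sum>k=1..N. chi (int k)) * ln_powr \<sigma> (real (Suc N)) + B"
      unfolding B_def
      using norm_sum_sum_le[OF assms(3)] A \<open>615 \<le> A\<close> that \<sigma>_ge \<sigma>(2)
      by (intro norm_sum_ln_powr_le[of "\<lambda>n. chi (int n)" Q] norm_chi_le) (auto simp: Q_def)
    \<comment> \<open>For fixed \<open>q\<close> the boundary term tends to 0 as \<open>N\<close>
      grows, so the trivial bound on the character sum suffices.\<close>
    also have "\<dots> \<le> real q * ln_powr \<sigma> (real (Suc N)) + B"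
      by (intro add_right_mono mult_right_mono norm_sum_le ln_powr_nonneg) simp
    finally show ?thesis .
  qed
  have "(\<lambda>N. ln_powr \<sigma> (real N)) \<longlonglongrightarrow> 0"
  proof -
    have "ln_powr \<sigma> (real N) = ln (real N) / real N powr \<sigma>" for N
      by (simp add: ln_powr_def powr_minus_divide)
    then show ?thesis using lim_ln_over_power[of \<sigma>] \<sigma>_ge by simp
  qed
  then have "(\<lambda>N. real q * ln_powr \<sigma> (real (Suc N)) + B) \<longlonglongrightarrow> real q * 0 + B"
    by (intro tendsto_intros LIMSEQ_Suc)
  with lim have "norm (deriv (dirichlet_L chi) (of_real \<sigma>)) \<le> real q * 0 + B"
    by (rule LIMSEQ_le) (use bound in blast)
  \<comment> \<open>\<open>t\<^sup>2 / 2\<close> equals the claimed bound because \<open>t\<close>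
    is half of \<open>ln q\<close>.\<close>
  also have "\<dots> \<le> 1 / 8 * (ln (real q))\<^sup>2"
    using B by (simp add: ln_q power_mult_distrib)
  finally show ?thesis .
qed

end
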